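(* Consider the one-dimensional isentropic one-velocity two-fluid system $$(\alpha^\pm\rho^\pm)_t+(\alpha^\pm\rho^\pm u)_x=0,\qquad (\rho u)_t+(\rho u^2+p)_x=0,$$ with $\alpha^++\alpha^-=1$, $\rho=\alpha^+\rho^++\alpha^-\rho^-$ and $\rho^\pm=R^\pm(p)$. Linearize it around a constant state with $\alpha^\pm\in(0,1)$, $\rho^\pm>0$ and velocity $u_0\in\mathbb{R}$. Then the eigenvalues of the linearized system are $u_0-c_w,\ u_0,\ u_0+c_w$, where $c_w>0$ is given by Wood's formula $$c_w^2=\frac{\rho^+\rho^-(c^+)^2(c^-)^2}{(\alpha^+\rho^++\alpha^-\rho^-)\left(\alpha^+\rho^-(c^-)^2+\alpha^-\rho^+(c^+)^2\right)},$$ equivalently $$\frac{1}{\rho\,c_w^2}=\frac{\alpha^+}{\rho^+(c^+)^2}+\frac{\alpha^-}{\rho^-(c^-)^2}.$$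
   Context: The two fluids are labelled $+$ and $-$; $\alpha^\pm$ are volume fractions, $\rho^\pm$ densities, $u$ the common velocity, $p$ the common pressure. There are three scalar equations (two mass equations, one momentum equation) for three unknowns, e.g. $(\alpha^+,p,u)$. The equations of state are smooth functions $\rho^\pm=R^\pm(p)>0$ with $dR^\pm/dp=1/(c^\pm)^2>0$, where $c^\pm>0$ is the speed of sound of the pure fluid $\pm$. Linearizing a first-order system around a constant state (keeping first-order terms in the perturbation) gives a constant-coefficient system $M\,\partial_tW+N\,\partial_xW=0$ with $M$ invertible; its eigenvalues are the eigenvalues of $M^{-1}N$, i.e. the roots $\lambda$ of $\det(N-\lambda M)=0$ (they do not depend on the choice of dependent variables). In the formulas all quantities are evaluated at the constant state. *)

theory Defs
  imports "HOL-Analysis.Analysis"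
begin

text \<open>The set \<open>P\<close> is the range of admissible pressures; off \<open>P\<close> the function \<open>R\<close> is arbitrary.\<close>

definition equation_of_state :: "real set \<Rightarrow> (real \<Rightarrow> real) \<Rightarrow> (real \<Rightarrow> real) \<Rightarrow> bool" where
  "equation_of_state P R c \<longleftrightarrow>
     open P \<and>
     (\<forall>n. (deriv ^^ n) R differentiable_on P) \<and>
     (\<forall>p\<in>P. R p > 0 \<and> c p > 0 \<and> (R has_real_derivative 1 / (c p)\<^sup>2) (at p))"

text \<open>
  A state is \<open>vector [\<alpha>, p, u]\<close>, where \<open>\<alpha>\<close> is the volume fraction of the fluid \<open>+\<close>
  (so that of the fluid \<open>-\<close> is \<open>1 - \<alpha>\<close>), \<open>p\<close> the common pressure and \<open>u\<close> the common velocity.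
\<close>

definition mixture_density :: "(real \<Rightarrow> real) \<Rightarrow> (real \<Rightarrow> real) \<Rightarrow> real \<Rightarrow> real \<Rightarrow> real" where
  "mixture_density Rp Rm \<alpha> p = \<alpha> * Rp p + (1 - \<alpha>) * Rm p"

definition two_fluid_conserved :: "(real \<Rightarrow> real) \<Rightarrow> (real \<Rightarrow> real) \<Rightarrow> real^3 \<Rightarrow> real^3" where
  "two_fluid_conserved Rp Rm W = (let \<alpha> = W $ 1; p = W $ 2; u = W $ 3 in
     vector [\<alpha> * Rp p,
             (1 - \<alpha>) * Rm p,
             mixture_density Rp Rm \<alpha> p * u])"

definition two_fluid_flux :: "(real \<Rightarrow> real) \<Rightarrow> (real \<Rightarrow> real) \<Rightarrow> real^3 \<Rightarrow> real^3" where
  "two_fluid_flux Rp Rm W = (let \<alpha> = W $ 1; p = W $ 2; u = W $ 3 in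
     vector [\<alpha> * Rp p * u,
             (1 - \<alpha>) * Rm p * u,
             mixture_density Rp Rm \<alpha> p * u\<^sup>2 + p])"

definition dt :: "(real \<times> real \<Rightarrow> real^'n) \<Rightarrow> real \<times> real \<Rightarrow> real^'n" where
  "dt w z = vector_derivative (\<lambda>s. w (s, snd z)) (at (fst z))"

definition dx :: "(real \<times> real \<Rightarrow> real^'n) \<Rightarrow> real \<times> real \<Rightarrow> real^'n" where
  "dx w z = vector_derivative (\<lambda>y. w (fst z, y)) (at (snd z))"

text \<open>The left-hand side of the system \<open>Q(W)\<^sub>t + F(W)\<^sub>x = 0\<close>, for a field \<open>W\<close> of the variables \<open>(t, x)\<close>.\<close>

definition conservation_lhs ::
  "(real^'n \<Rightarrow> real^'n) \<Rightarrow> (real^'n \<Rightarrow> real^'n) \<Rightarrow> (real \<times> real \<Rightarrow> real^'n) \<Rightarrow> real \<times> real \<Rightarrow> real^'n" where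
  "conservation_lhs Q F W z = dt (\<lambda>y. Q (W y)) z + dx (\<lambda>y. F (W y)) z"

text \<open>
  \<open>M w\<^sub>t + N w\<^sub>x\<close> is the first-order term in \<open>\<epsilon>\<close> of the left-hand side of the system evaluated
  at the perturbed constant state \<open>W0 + \<epsilon> w\<close>. For each \<open>(t, x)\<close> only small \<open>\<epsilon>\<close> matter, so
  \<open>w\<close> need not be bounded.
\<close>

definition is_linearization ::
  "(real^'n \<Rightarrow> real^'n) \<Rightarrow> (real^'n \<Rightarrow> real^'n) \<Rightarrow> real^'n \<Rightarrow> real^'n^'n \<Rightarrow> real^'n^'n \<Rightarrow> bool" where
  "is_linearization Q F W0 M N \<longleftrightarrow>
     (\<forall>w z. w differentiable_on UNIV \<longrightarrow>
        ((\<lambda>\<epsilon>. conservation_lhs Q F (\<lambda>y. W0 + \<epsilon> *\<^sub>R w y) z)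
           has_vector_derivative (M *v dt w z + N *v dx w z)) (at 0))"

definition eigenvalues :: "'a::field^'n^'n \<Rightarrow> 'a set" where
  "eigenvalues A = {\<mu>. \<exists>v. v \<noteq> 0 \<and> A *v v = \<mu> *s v}"

end

(* Differentiating the conservation laws along constant states turns M and N into the Jacobians of
   the conserved quantities and of the flux, and M is invertible because its determinant is
   \<rho> (\<alpha>p \<rho>m / ap^2 + \<alpha>m \<rho>p / am^2) > 0. Passing to the variables (\<alpha>, p, u), the product A = M^-1 N
   is u0 I plus a matrix coupling only u with p and \<alpha>:
   D\<alpha> + b u_x = 0,  Dp + \<rho> c_w^2 u_x = 0,  Du + p_x / \<rho> = 0,  where D = \<partial>_t + u0 \<partial>_x,
   whose characteristic polynomial is (\<mu> - u0) ((\<mu> - u0)^2 - c_w^2). *)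
theory Submission
  imports Defs
begin

section \<open>Linearization of a conservation law at a constant state\<close>

text \<open>The difference quotient of \<open>\<epsilon> *\<^sub>R h \<epsilon>\<close> at 0 is
  \<open>h \<epsilon>\<close> itself, so continuity of \<open>h\<close> at 0 suffices and no
  differentiability is asked of it.\<close>

lemma has_vector_derivative_scaleR_at_0:
  fixes h :: "real \<Rightarrow> 'a::real_normed_vector"
  assumes "isCont h 0"
  shows "((\<lambda>\<epsilon>. \<epsilon> *\<^sub>R h \<epsilon>) has_vector_derivative h 0) (at 0)"
proof -
  have "(\<lambda>y. norm (h y - h 0)) \<midarrow>0\<rightarrow> 0"
    using assms unfolding isCont_def by (intro tendsto_norm_zero) (simp add: LIM_zero)
  then have "(\<lambda>y. norm (y *\<^sub>R h y - y *\<^sub>R h 0) / norm y) \<midarrow>0\<rightarrow> 0"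
    by (rule Lim_transform_eventually) (simp add: eventually_at_filter flip: scaleR_diff_right)
  then show ?thesis
    by (simp add: has_vector_derivative_def has_derivative_iff_norm bounded_linear_scaleR_left)
qed

lemma isCont_matrix_vector_mult:
  fixes A :: "'a::t2_space \<Rightarrow> real^'n^'m"
  assumes "isCont A x"
  shows "isCont (\<lambda>y. A y *v v) x"
  using assms unfolding matrix_vector_mult_def isCont_def
  by (intro tendsto_vec_lambda tendsto_sum tendsto_mult tendsto_const tendsto_vec_nth)

text \<open>\<open>dt\<close> is a \<open>vector_derivative\<close>, which is informative only where
  the derivative exists. Composing \<open>w\<close> with the line through \<open>z\<close> parallel
  to the time axis supplies that existence.\<close>

lemma has_vector_derivative_dt:
  assumes "w differentiable at z"
  shows "((\<lambda>s. w (s, snd z)) has_vector_derivative dt w z) (at (fst z))"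
proof -
  obtain w' where w': "(w has_derivative w') (at z)"
    using assms by (auto simp: differentiable_def)
  have "((\<lambda>s. (s, snd z)) has_derivative (\<lambda>s. (s, 0))) (at (fst z))"
    by (auto intro!: derivative_eq_intros)
  then have "((\<lambda>s. w (s, snd z)) has_derivative (\<lambda>s. w' (s, 0))) (at (fst z))"
    using has_derivative_compose[of "\<lambda>s. (s, snd z)" _ "fst z" UNIV w w'] w' by simp
  then have "(\<lambda>s. w (s, snd z)) differentiable at (fst z)"
    by (auto simp: differentiable_def)
  then show ?thesis
    unfolding dt_def by (rule vector_derivative_works[THEN iffD1])
qed

lemma has_vector_derivative_dx:
  assumes "w differentiable at z"
  shows "((\<lambda>y. w (fst z, y)) has_vector_derivative dx w z) (at (snd z))"
proof -
  obtain w' where w': "(w has_derivative w') (at z)"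
    using assms by (auto simp: differentiable_def)
  have "((\<lambda>y. (fst z, y)) has_derivative (\<lambda>y. (0, y))) (at (snd z))"
    by (auto intro!: derivative_eq_intros)
  then have "((\<lambda>y. w (fst z, y)) has_derivative (\<lambda>y. w' (0, y))) (at (snd z))"
    using has_derivative_compose[of "\<lambda>y. (fst z, y)" _ "snd z" UNIV w w'] w' by simp
  then have "(\<lambda>y. w (fst z, y)) differentiable at (snd z)"
    by (auto simp: differentiable_def)
  then show ?thesis
    unfolding dx_def by (rule vector_derivative_works[THEN iffD1])
qed

text \<open>Linearity of \<open>J\<close> lets the chain rule release an explicit factor \<epsilon>,
  which isolates the first-order term of the perturbed system.\<close>

lemma has_vector_derivative_compose_perturbation:
  fixes Q :: "real^'n \<Rightarrow> real^'n"
  assumes "(g has_vector_derivative g') (at t)"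
    and "(Q has_derivative (*v) J) (at (W0 + \<epsilon> *\<^sub>R g t))"
  shows "((\<lambda>s. Q (W0 + \<epsilon> *\<^sub>R g s)) has_vector_derivative \<epsilon> *\<^sub>R (J *v g')) (at t)"
proof -
  have "((\<lambda>s. W0 + \<epsilon> *\<^sub>R g s) has_vector_derivative \<epsilon> *\<^sub>R g') (at t)"
    using assms(1) by (auto intro!: derivative_eq_intros)
  from vector_derivative_diff_chain_within[OF this has_derivative_at_withinI, OF assms(2)]
  show ?thesis
    by (simp add: o_def matrix_vector_mult_scaleR)
qed

text \<open>At a fixed point \<open>z\<close> the left-hand side of the system is \<epsilon> times a
  function \<open>h\<close> that evaluates the Jacobians at the perturbed state. Its derivative at 0
  is \<open>h 0\<close>, so continuity of the Jacobians at \<open>W0\<close> replaces any use of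
  second derivatives.\<close>

lemma is_linearization_jacobians:
  fixes Q F :: "real^'n \<Rightarrow> real^'n"
  assumes U: "open U" "W0 \<in> U"
    and Q: "\<And>W. W \<in> U \<Longrightarrow> (Q has_derivative (*v) (JQ W)) (at W)" "isCont JQ W0"
    and F: "\<And>W. W \<in> U \<Longrightarrow> (F has_derivative (*v) (JF W)) (at W)" "isCont JF W0"
  shows "is_linearization Q F W0 (JQ W0) (JF W0)"
  unfolding is_linearization_def
proof (intro allI impI)
  fix w :: "real \<times> real \<Rightarrow> real^'n" and z
  assume "w differentiable_on UNIV"
  then have w: "w differentiable at z"
    unfolding differentiable_on_def by blast
  define h where
    "h \<epsilon> = JQ (W0 + \<epsilon> *\<^sub>R w z) *v dt w z + JF (W0 + \<epsilon> *\<^sub>R w z) *v dx w z" for \<epsilon>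
  \<comment> \<open>Only the value of the perturbed state at the single point \<open>z\<close> has
    to lie in \<open>U\<close>. This holds for all small \<epsilon>, even if \<open>w\<close> is
    unbounded.\<close>
  define E where "E = (\<lambda>\<epsilon>. W0 + \<epsilon> *\<^sub>R w z) -` U"
  have "open E"
    unfolding E_def by (intro open_vimage U continuous_intros)
  moreover have "0 \<in> E"
    using U by (simp add: E_def)
  moreover have "\<epsilon> *\<^sub>R h \<epsilon> = conservation_lhs Q F (\<lambda>y. W0 + \<epsilon> *\<^sub>R w y) z" if "\<epsilon> \<in> E" for \<epsilon>
  proof -
    have W: "W0 + \<epsilon> *\<^sub>R w z \<in> U"
      using that by (simp add: E_def)
    have "dt (\<lambda>y. Q (W0 + \<epsilon> *\<^sub>R w y)) z = \<epsilon> *\<^sub>R (JQ (W0 + \<epsilon> *\<^sub>R w z) *v dt w z)"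
      unfolding dt_def[of "\<lambda>y. Q (W0 + \<epsilon> *\<^sub>R w y)"]
      by (intro vector_derivative_at has_vector_derivative_compose_perturbation
            has_vector_derivative_dt w) (simp add: Q W)
    moreover have "dx (\<lambda>y. F (W0 + \<epsilon> *\<^sub>R w y)) z = \<epsilon> *\<^sub>R (JF (W0 + \<epsilon> *\<^sub>R w z) *v dx w z)"
      unfolding dx_def[of "\<lambda>y. F (W0 + \<epsilon> *\<^sub>R w y)"]
      by (intro vector_derivative_at has_vector_derivative_compose_perturbation
            has_vector_derivative_dx w) (simp add: F W)
    ultimately show ?thesis
      by (simp add: conservation_lhs_def h_def scaleR_add_right)
  qed
  moreover have "isCont h 0"
  proof -
    have line: "isCont (\<lambda>\<epsilon>. W0 + \<epsilon> *\<^sub>R w z) 0"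
      by (intro continuous_intros)
    show ?thesis
      unfolding h_def
      by (intro continuous_intros isCont_matrix_vector_mult isCont_o2[OF line]) (simp_all add: Q F)
  qed
  then have "((\<lambda>\<epsilon>. \<epsilon> *\<^sub>R h \<epsilon>) has_vector_derivative h 0) (at 0)"
    by (rule has_vector_derivative_scaleR_at_0)
  ultimately have "((\<lambda>\<epsilon>. conservation_lhs Q F (\<lambda>y. W0 + \<epsilon> *\<^sub>R w y) z) has_vector_derivative h 0) (at 0)"
    by (rule has_vector_derivative_transform_within_open[rotated])
  then show "((\<lambda>\<epsilon>. conservation_lhs Q F (\<lambda>y. W0 + \<epsilon> *\<^sub>R w y) z) has_vector_derivative
      JQ W0 *v dt w z + JF W0 *v dx w z) (at 0)"
    by (simp add: h_def)
qed

text \<open>The test fields \<open>fst z *\<^sub>R a\<close> and \<open>snd z *\<^sub>R a\<close>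
  separate the two matrices: at the origin the first has time derivative \<open>a\<close> and space
  derivative 0, the second the reverse.\<close>

lemma is_linearization_unique:
  fixes Q F :: "real^'n \<Rightarrow> real^'n"
  assumes "is_linearization Q F W0 M N" and "is_linearization Q F W0 M' N'"
  shows "M' = M \<and> N' = N"
proof -
  have eq: "M' *v dt w z + N' *v dx w z = M *v dt w z + N *v dx w z"
    if "w differentiable_on UNIV" for w z
    using assms that unfolding is_linearization_def by (blast intro: vector_derivative_unique_at)
  have "M' *v a = M *v a" for a
  proof -
    have "dt (\<lambda>z. fst z *\<^sub>R a) 0 = a" "dx (\<lambda>z. fst z *\<^sub>R a) 0 = 0"
      unfolding dt_def dx_def by (auto intro!: vector_derivative_at derivative_eq_intros)
    moreover have "(\<lambda>z::real \<times> real. fst z *\<^sub>R a) differentiable_on UNIV"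
      by (intro bounded_linear_imp_differentiable_on bounded_linear_intros)
    ultimately show ?thesis
      using eq[of "\<lambda>z. fst z *\<^sub>R a" 0] by simp
  qed
  moreover have "N' *v a = N *v a" for a
  proof -
    have "dt (\<lambda>z. snd z *\<^sub>R a) 0 = 0" "dx (\<lambda>z. snd z *\<^sub>R a) 0 = a"
      unfolding dt_def dx_def by (auto intro!: vector_derivative_at derivative_eq_intros)
    moreover have "(\<lambda>z::real \<times> real. snd z *\<^sub>R a) differentiable_on UNIV"
      by (intro bounded_linear_imp_differentiable_on bounded_linear_intros)
    ultimately show ?thesis
      using eq[of "\<lambda>z. snd z *\<^sub>R a" 0] by simp
  qed
  ultimately show ?thesis
    by (simp add: matrix_eq)
qed

section \<open>The two-fluid system\<close>

lemma has_derivative_real3I: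
  fixes f :: "'a::real_normed_vector \<Rightarrow> real^3"
  assumes "((\<lambda>x. f x $ 1) has_derivative (\<lambda>x. f' x $ 1)) (at a)"
    and "((\<lambda>x. f x $ 2) has_derivative (\<lambda>x. f' x $ 2)) (at a)"
    and "((\<lambda>x. f x $ 3) has_derivative (\<lambda>x. f' x $ 3)) (at a)"
  shows "(f has_derivative f') (at a)"
proof -
  have "\<forall>i::3. ((\<lambda>x. f x $ i) has_derivative (\<lambda>x. f' x $ i)) (at a)"
    using assms by (simp add: forall_3)
  then show ?thesis
    by (subst has_derivative_componentwise_within) (auto simp: Basis_vec_def inner_axis)
qed

lemma isCont_vector3:
  fixes f g h :: "'a::t2_space \<Rightarrow> 'b::{topological_space,zero}"
  assumes "isCont f x" "isCont g x" "isCont h x"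
  shows "isCont (\<lambda>y. vector [f y, g y, h y] :: 'b^3) x"
proof -
  have "\<forall>i::3. ((\<lambda>y. (vector [f y, g y, h y] :: 'b^3) $ i) \<longlongrightarrow> vector [f x, g x, h x] $ i) (at x)"
    using assms by (simp add: forall_3 isCont_def)
  then show ?thesis
    unfolding isCont_def by (intro vec_tendstoI) blast
qed

lemma matrix_mult_vec3:
  "(vector [vector [a, b, c], vector [d, e, f], vector [g, h, i]] :: 'a::semiring_1^3^3) *v v =
    vector [a * v $ 1 + b * v $ 2 + c * v $ 3,
            d * v $ 1 + e * v $ 2 + f * v $ 3,
            g * v $ 1 + h * v $ 2 + i * v $ 3]"
  by (simp add: vec_eq_iff forall_3 matrix_vector_mult_def sum_3)

text \<open>The columns belong to \<alpha>, p and u. The slopes of the equations of state enter as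
  functions, so that the Jacobian becomes a function of the state whose continuity can be
  stated.\<close>

definition two_fluid_conserved_jacobian ::
  "(real \<Rightarrow> real) \<Rightarrow> (real \<Rightarrow> real) \<Rightarrow> (real \<Rightarrow> real) \<Rightarrow> (real \<Rightarrow> real) \<Rightarrow> real^3 \<Rightarrow> real^3^3" where
  "two_fluid_conserved_jacobian Rp Rm Rp' Rm' W = (let \<alpha> = W $ 1; p = W $ 2; u = W $ 3 in
     vector [vector [Rp p, \<alpha> * Rp' p, 0],
             vector [- Rm p, (1 - \<alpha>) * Rm' p, 0],
             vector [(Rp p - Rm p) * u, mixture_density Rp' Rm' \<alpha> p * u, mixture_density Rp Rm \<alpha> p]])"

definition two_fluid_flux_jacobian ::
  "(real \<Rightarrow> real) \<Rightarrow> (real \<Rightarrow> real) \<Rightarrow> (real \<Rightarrow> real) \<Rightarrow> (real \<Rightarrow> real) \<Rightarrow> real^3 \<Rightarrow> real^3^3" where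
  "two_fluid_flux_jacobian Rp Rm Rp' Rm' W = (let \<alpha> = W $ 1; p = W $ 2; u = W $ 3 in
     vector [vector [Rp p * u, \<alpha> * Rp' p * u, \<alpha> * Rp p],
             vector [- Rm p * u, (1 - \<alpha>) * Rm' p * u, (1 - \<alpha>) * Rm p],
             vector [(Rp p - Rm p) * u\<^sup>2, mixture_density Rp' Rm' \<alpha> p * u\<^sup>2 + 1,
                     2 * mixture_density Rp Rm \<alpha> p * u]])"

lemma has_derivative_comp_vec_nth:
  assumes "(R has_real_derivative D) (at (W $ i))"
  shows "((\<lambda>W. R (W $ i)) has_derivative (\<lambda>v. D * v $ i)) (at W)"
  using has_derivative_compose[OF bounded_linear.has_derivative[OF bounded_linear_vec_nth has_derivative_ident],
      of R "(*) D" W i UNIV] assms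
  by (simp add: has_field_derivative_def)

lemma two_fluid_conserved_has_derivative:
  assumes "(Rp has_real_derivative Rp' (W $ 2)) (at (W $ 2))"
    and "(Rm has_real_derivative Rm' (W $ 2)) (at (W $ 2))"
  shows "(two_fluid_conserved Rp Rm has_derivative
    (*v) (two_fluid_conserved_jacobian Rp Rm Rp' Rm' W)) (at W)"
  by (rule has_derivative_real3I;
      simp add: two_fluid_conserved_def two_fluid_conserved_jacobian_def mixture_density_def
        Let_def matrix_mult_vec3)
    (auto intro!: derivative_eq_intros assms[THEN has_derivative_comp_vec_nth]
        bounded_linear.has_derivative[OF bounded_linear_vec_nth] simp: algebra_simps)

lemma two_fluid_flux_has_derivative:
  assumes "(Rp has_real_derivative Rp' (W $ 2)) (at (W $ 2))"
    and "(Rm has_real_derivative Rm' (W $ 2)) (at (W $ 2))"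
  shows "(two_fluid_flux Rp Rm has_derivative
    (*v) (two_fluid_flux_jacobian Rp Rm Rp' Rm' W)) (at W)"
  by (rule has_derivative_real3I;
      simp add: two_fluid_flux_def two_fluid_flux_jacobian_def mixture_density_def
        Let_def matrix_mult_vec3)
    (auto intro!: derivative_eq_intros assms[THEN has_derivative_comp_vec_nth]
        bounded_linear.has_derivative[OF bounded_linear_vec_nth] simp: algebra_simps power2_eq_square)

lemma isCont_two_fluid_jacobians:
  assumes "isCont Rp (W $ 2)" "isCont Rm (W $ 2)" "isCont Rp' (W $ 2)" "isCont Rm' (W $ 2)"
  shows "isCont (two_fluid_conserved_jacobian Rp Rm Rp' Rm') W"
    and "isCont (two_fluid_flux_jacobian Rp Rm Rp' Rm') W"
proof -
  have nth: "isCont (\<lambda>W::real^3. W $ i) W" for i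
    by (intro continuous_intros)
  note comp = assms[THEN isCont_o2[OF nth]]
  show "isCont (two_fluid_conserved_jacobian Rp Rm Rp' Rm') W"
    unfolding two_fluid_conserved_jacobian_def mixture_density_def Let_def
    by (intro isCont_vector3 continuous_intros comp nth)
  show "isCont (two_fluid_flux_jacobian Rp Rm Rp' Rm') W"
    unfolding two_fluid_flux_jacobian_def mixture_density_def Let_def
    by (intro isCont_vector3 continuous_intros comp nth)
qed

text \<open>Continuity comes from the smoothness of \<open>R\<close>, not from \<open>c\<close>: on
  \<open>P\<close> the function agrees with \<open>deriv R\<close>, which is differentiable there,
  and \<open>P\<close> is open.\<close>

lemma equation_of_state_isCont_derivative:
  assumes "equation_of_state P R c" "p \<in> P"
  shows "isCont (\<lambda>p. 1 / (c p)\<^sup>2) p"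
proof -
  have P: "open P" and "(deriv ^^ 1) R differentiable_on P"
    and d: "\<And>p. p \<in> P \<Longrightarrow> deriv R p = 1 / (c p)\<^sup>2"
    using assms(1) unfolding equation_of_state_def by (blast intro: DERIV_imp_deriv)+
  from this(2) have "continuous_on P (deriv R)"
    by (simp add: differentiable_imp_continuous_on)
  then have "continuous_on P (\<lambda>p. 1 / (c p)\<^sup>2)"
    by (rule continuous_on_eq) (rule d)
  then show ?thesis
    using P assms(2) by (simp add: continuous_on_eq_continuous_at)
qed

section \<open>Eigenvalues\<close>

text \<open>After subtracting u times the identity, only the second and third components feed back
  on each other, and their coupling squares to \<open>k * r\<close>; the first is merely driven by
  the third. A general field is used so that the result applies to complex matrices.\<close>

lemma eigenvalues_acoustic:
  fixes u b k r c :: "'a::field"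
  assumes "r \<noteq> 0" and "k * r = c\<^sup>2" and "c \<noteq> 0"
  shows "eigenvalues (vector [vector [u, 0, b], vector [0, u, k], vector [0, r, u]] :: 'a^3^3) =
    {u - c, u, u + c}" (is "eigenvalues ?A = _")
proof -
  have eig: "?A *v v = \<mu> *s v \<longleftrightarrow>
      (\<mu> - u) * v $ 1 = b * v $ 3 \<and> (\<mu> - u) * v $ 2 = k * v $ 3 \<and> (\<mu> - u) * v $ 3 = r * v $ 2" for v :: "'a^3" and \<mu>
  proof -
    have "u * x + y = \<mu> * x \<longleftrightarrow> (\<mu> - u) * x = y" "y + u * x = \<mu> * x \<longleftrightarrow> (\<mu> - u) * x = y" for x y
      by (metis add.commute diff_eq_eq left_diff_distrib)+
    then show ?thesis
      by (simp add: matrix_mult_vec3 vec_eq_iff forall_3)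
  qed
  have "k \<noteq> 0"
    using assms by auto
  show ?thesis
  proof (intro equalityI subsetI)
    fix \<mu> assume "\<mu> \<in> eigenvalues ?A"
    then obtain v :: "'a^3" where v: "v \<noteq> 0" and e: "(\<mu> - u) * v $ 1 = b * v $ 3"
      "(\<mu> - u) * v $ 2 = k * v $ 3" "(\<mu> - u) * v $ 3 = r * v $ 2"
      unfolding eigenvalues_def eig by blast
    show "\<mu> \<in> {u - c, u, u + c}"
    proof (cases "v $ 3 = 0")
      case True
      then have "v $ 2 = 0"
        using e(3) assms(1) by simp
      with True v have "v $ 1 \<noteq> 0"
        by (simp add: vec_eq_iff forall_3)
      then show ?thesis
        using e(1) True by simp
    next
      case False
      \<comment> \<open>Multiplying the third equation by \<open>\<mu> - u\<close> and inserting the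
        second eliminates \<open>v $ 2\<close>.\<close>
      have "(\<mu> - u)\<^sup>2 * v $ 3 = r * ((\<mu> - u) * v $ 2)"
        using e(3) by (simp add: power2_eq_square mult.assoc mult.left_commute)
      also have "\<dots> = c\<^sup>2 * v $ 3"
        by (simp add: e(2) mult.left_commute flip: assms(2))
      finally have "(\<mu> - u)\<^sup>2 = c\<^sup>2"
        using False by simp
      then show ?thesis
        by (auto simp: power2_eq_iff algebra_simps)
    qed
  next
    fix \<mu> assume \<mu>: "\<mu> \<in> {u - c, u, u + c}"
    show "\<mu> \<in> eigenvalues ?A"
    proof (cases "\<mu> = u")
      case True
      have "(vector [1, 0, 0] :: 'a^3) \<noteq> 0"
        by (simp add: vec_eq_iff forall_3)
      then show ?thesis
        unfolding eigenvalues_def eig mem_Collect_eq using True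
        by (intro exI[of _ "vector [1, 0, 0]"]) simp
    next
      case False
      with \<mu> have d: "(\<mu> - u)\<^sup>2 = k * r"
        by (auto simp: assms(2))
      \<comment> \<open>Setting the third component to \<open>\<mu> - u\<close> makes the first two
        equations give \<open>b\<close> and \<open>k\<close>; the third equation then reads
        \<open>(\<mu> - u)\<^sup>2 = k * r\<close>.\<close>
      have "(vector [b, k, \<mu> - u] :: 'a^3) \<noteq> 0"
        using \<open>k \<noteq> 0\<close> by (simp add: vec_eq_iff forall_3)
      then show ?thesis
        unfolding eigenvalues_def eig mem_Collect_eq using d
        by (intro exI[of _ "vector [b, k, \<mu> - u]"]) (simp add: power2_eq_square mult.commute)
    qed
  qed
qed

text \<open>The equivalence for \<open>M'\<close> and \<open>N'\<close> ties the eigenvalues to the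
  system rather than to a choice of matrices. Passing to complex matrices ensures that the three
  real values are the whole spectrum.\<close>

theorem mainTheorem1:
  fixes Rp Rm cp cm :: "real \<Rightarrow> real" and P :: "real set" and \<alpha>p \<alpha>m p0 u0 \<rho>p \<rho>m ap am \<rho> :: real
  assumes "equation_of_state P Rp cp" and "equation_of_state P Rm cm"
    and "p0 \<in> P"
    and "0 < \<alpha>p" and "\<alpha>p < 1" and "\<alpha>m = 1 - \<alpha>p"
    and "\<rho>p = Rp p0" and "\<rho>m = Rm p0" and "ap = cp p0" and "am = cm p0"
    and "\<rho> = \<alpha>p * \<rho>p + \<alpha>m * \<rho>m"
  shows "\<exists>M N cw.
     (\<forall>M' N'. is_linearization (two_fluid_conserved Rp Rm) (two_fluid_flux Rp Rm)
                (vector [\<alpha>p, p0, u0]) M' N' \<longleftrightarrow> M' = M \<and> N' = N) \<and>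
     invertible M \<and>
     cw > 0 \<and>
     cw\<^sup>2 = (\<rho>p * \<rho>m * ap\<^sup>2 * am\<^sup>2)
             / ((\<alpha>p * \<rho>p + \<alpha>m * \<rho>m) * (\<alpha>p * \<rho>m * am\<^sup>2 + \<alpha>m * \<rho>p * ap\<^sup>2)) \<and>
     (\<forall>c>0. c\<^sup>2 = (\<rho>p * \<rho>m * ap\<^sup>2 * am\<^sup>2)
             / ((\<alpha>p * \<rho>p + \<alpha>m * \<rho>m) * (\<alpha>p * \<rho>m * am\<^sup>2 + \<alpha>m * \<rho>p * ap\<^sup>2))
        \<longleftrightarrow> 1 / (\<rho> * c\<^sup>2) = \<alpha>p / (\<rho>p * ap\<^sup>2) + \<alpha>m / (\<rho>m * am\<^sup>2)) \<and>
     eigenvalues (map_matrix complex_of_real (matrix_inv M ** N))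
       = complex_of_real ` {u0 - cw, u0, u0 + cw}"
proof -
  define dp dm where "dp = 1 / ap\<^sup>2" and "dm = 1 / am\<^sup>2"
  \<comment> \<open>\<open>S\<close> is the determinant of the upper left 2x2 block of
    \<open>M\<close>. By Cramer's rule, \<open>b\<close> and \<open>k\<close> below solve the two
    mass equations with that block; here \<open>k\<close> is \<rho> times the square of the wave
    speed.\<close>
  define S where "S = \<alpha>p * \<rho>m * dp + \<alpha>m * \<rho>p * dm"
  define k b where "k = \<rho>p * \<rho>m / S" and "b = \<alpha>p * \<alpha>m * (\<rho>p * dm - \<rho>m * dp) / S"
  define cw where "cw = sqrt (k / \<rho>)"
  define W0 :: "real^3" where "W0 = vector [\<alpha>p, p0, u0]"
  let ?Rp' = "\<lambda>p. 1 / (cp p)\<^sup>2" and ?Rm' = "\<lambda>p. 1 / (cm p)\<^sup>2"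
  define M where "M = two_fluid_conserved_jacobian Rp Rm ?Rp' ?Rm' W0"
  define N where "N = two_fluid_flux_jacobian Rp Rm ?Rp' ?Rm' W0"
  \<comment> \<open>The candidate for \<open>matrix_inv M ** N\<close>: the system solved for its
    time derivatives. It is checked through \<open>N = M ** A\<close>, so \<open>M\<close> is never
    inverted explicitly.\<close>
  define A :: "real^3^3" where
    "A = vector [vector [u0, 0, b], vector [0, u0, k], vector [0, 1 / \<rho>, u0]]"

  have pos: "\<rho>p > 0" "\<rho>m > 0" "ap > 0" "am > 0" "\<alpha>m > 0" "dp > 0" "dm > 0"
    using assms by (auto simp: equation_of_state_def dp_def dm_def)
  then have "\<rho> > 0" "S > 0"
    using \<open>0 < \<alpha>p\<close> by (auto simp: assms(11) S_def intro!: add_pos_pos mult_pos_pos)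
  then have "k > 0"
    using pos by (simp add: k_def)
  then have "cw > 0" and cw2: "cw\<^sup>2 = k / \<rho>"
    using \<open>\<rho> > 0\<close> by (auto simp: cw_def)

  have M: "M = vector [vector [\<rho>p, \<alpha>p * dp, 0], vector [- \<rho>m, \<alpha>m * dm, 0],
      vector [(\<rho>p - \<rho>m) * u0, (\<alpha>p * dp + \<alpha>m * dm) * u0, \<rho>]]"
    using assms
    by (simp add: M_def W0_def two_fluid_conserved_jacobian_def mixture_density_def dp_def dm_def)
  have N: "N = vector [vector [\<rho>p * u0, \<alpha>p * dp * u0, \<alpha>p * \<rho>p],
      vector [- \<rho>m * u0, \<alpha>m * dm * u0, \<alpha>m * \<rho>m],
      vector [(\<rho>p - \<rho>m) * u0\<^sup>2, (\<alpha>p * dp + \<alpha>m * dm) * u0\<^sup>2 + 1, 2 * \<rho> * u0]]"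
    using assms
    by (simp add: N_def W0_def two_fluid_flux_jacobian_def mixture_density_def dp_def dm_def)
  \<comment> \<open>The third column of \<open>M\<close> has \<rho> as its only nonzero entry, which
    leaves the determinant of the block.\<close>
  have "det M = \<rho> * S"
    by (simp add: M det_3 S_def algebra_simps)
  then have "invertible M"
    using \<open>\<rho> > 0\<close> \<open>S > 0\<close> by (simp add: invertible_det_nz)

  \<comment> \<open>This identity and the next are the first two entries of the third column of
    \<open>N = M ** A\<close>. After clearing \<open>S\<close> they rest on the volume fractions
    summing to 1.\<close>
  have mass_p: "\<rho>p * b + \<alpha>p * dp * k = \<alpha>p * \<rho>p"
  proof -
    have "(\<rho>p * b + \<alpha>p * dp * k) * S = \<alpha>p * \<rho>p * S"
      using \<open>S > 0\<close> unfolding b_def k_def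
      by (simp add: distrib_right) (simp add: S_def assms(6) algebra_simps)
    then show ?thesis
      using \<open>S > 0\<close> by simp
  qed
  have mass_m: "- \<rho>m * b + \<alpha>m * dm * k = \<alpha>m * \<rho>m"
  proof -
    have "(- \<rho>m * b + \<alpha>m * dm * k) * S = \<alpha>m * \<rho>m * S"
      using \<open>S > 0\<close> unfolding b_def k_def
      by (simp add: left_diff_distrib) (simp add: S_def assms(6) algebra_simps)
    then show ?thesis
      using \<open>S > 0\<close> by simp
  qed
  \<comment> \<open>The last entry of that column is \<open>u0\<close> times the sum of the two mass
    identities, plus the term \<open>\<rho> * u0\<close> from the diagonal of
    \<open>A\<close>.\<close>
  have "(\<rho>p - \<rho>m) * u0 * b + (\<alpha>p * dp + \<alpha>m * dm) * u0 * k =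
      ((\<rho>p * b + \<alpha>p * dp * k) + (- \<rho>m * b + \<alpha>m * dm * k)) * u0"
    by (simp add: algebra_simps)
  also have "\<dots> = \<rho> * u0"
    by (simp only: mass_p mass_m assms(11))
  finally have momentum: "(\<rho>p - \<rho>m) * u0 * b + (\<alpha>p * dp + \<alpha>m * dm) * u0 * k = \<rho> * u0" .
  have "N = M ** A"
    using mass_p mass_m momentum \<open>\<rho> > 0\<close>
    by (simp add: vec_eq_iff forall_3 M N A_def matrix_matrix_mult_def sum_3 power2_eq_square)
  moreover have "matrix_inv M ** M = mat 1"
    using someI_ex[OF \<open>invertible M\<close>[unfolded invertible_def]] by (simp add: matrix_inv_def)
  ultimately have "matrix_inv M ** N = A"
    by (simp add: matrix_mul_assoc)
  moreover have "map_matrix complex_of_real A = vector [vector [complex_of_real u0, 0, complex_of_real b],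
      vector [0, complex_of_real u0, complex_of_real k],
      vector [0, complex_of_real (1 / \<rho>), complex_of_real u0]]"
    by (simp add: vec_eq_iff forall_3 A_def)
  moreover have "complex_of_real k * complex_of_real (1 / \<rho>) = (complex_of_real cw)\<^sup>2"
    by (simp add: cw2 flip: of_real_mult of_real_power)
  ultimately have eig: "eigenvalues (map_matrix complex_of_real (matrix_inv M ** N))
      = complex_of_real ` {u0 - cw, u0, u0 + cw}"
    using eigenvalues_acoustic[of "complex_of_real (1 / \<rho>)" "complex_of_real k" "complex_of_real cw"]
      \<open>\<rho> > 0\<close> \<open>cw > 0\<close> by simp

  have lin: "is_linearization (two_fluid_conserved Rp Rm) (two_fluid_flux Rp Rm) W0 M N"
    unfolding M_def N_def
  proof (rule is_linearization_jacobians)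
    \<comment> \<open>Admissible pressure is the only restriction on the neighbourhood, since the
      equations of state are controlled exactly on \<open>P\<close>.\<close>
    show "open {W :: real^3. W $ 2 \<in> P}"
      using assms(1) by (intro open_vimage_vec_nth[unfolded vimage_def]) (simp add: equation_of_state_def)
    show "W0 \<in> {W. W $ 2 \<in> P}"
      using \<open>p0 \<in> P\<close> by (simp add: W0_def)
    have d: "(Rp has_real_derivative ?Rp' p) (at p)" "(Rm has_real_derivative ?Rm' p) (at p)"
      if "p \<in> P" for p
      using that assms(1,2) by (auto simp: equation_of_state_def)
    then show "(two_fluid_conserved Rp Rm has_derivative
        (*v) (two_fluid_conserved_jacobian Rp Rm ?Rp' ?Rm' W)) (at W)"
      "(two_fluid_flux Rp Rm has_derivative
        (*v) (two_fluid_flux_jacobian Rp Rm ?Rp' ?Rm' W)) (at W)" if "W \<in> {W. W $ 2 \<in> P}" for W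
      using that by (simp_all add: two_fluid_conserved_has_derivative two_fluid_flux_has_derivative)
    show "isCont (two_fluid_conserved_jacobian Rp Rm ?Rp' ?Rm') W0"
      "isCont (two_fluid_flux_jacobian Rp Rm ?Rp' ?Rm') W0"
      using d[OF \<open>p0 \<in> P\<close>] assms(1-3)
      by (auto intro!: isCont_two_fluid_jacobians equation_of_state_isCont_derivative
          intro: DERIV_isCont simp: W0_def)
  qed
  have uniq: "is_linearization (two_fluid_conserved Rp Rm) (two_fluid_flux Rp Rm) W0 M' N'
      \<longleftrightarrow> M' = M \<and> N' = N" for M' N'
    using lin is_linearization_unique by blast

  define C where "C = (\<rho>p * \<rho>m * ap\<^sup>2 * am\<^sup>2)
    / ((\<alpha>p * \<rho>p + \<alpha>m * \<rho>m) * (\<alpha>p * \<rho>m * am\<^sup>2 + \<alpha>m * \<rho>p * ap\<^sup>2))"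
  \<comment> \<open>Clearing the squared sound speeds turns \<open>S\<close> into the second factor
    of Wood's denominator.\<close>
  have "S = (\<alpha>p * \<rho>m * am\<^sup>2 + \<alpha>m * \<rho>p * ap\<^sup>2) / (ap\<^sup>2 * am\<^sup>2)"
    using pos by (simp add: S_def dp_def dm_def field_simps)
  then have C: "C = k / \<rho>"
    by (simp add: C_def k_def assms(11) mult.assoc mult.commute)
  have "\<alpha>p / (\<rho>p * ap\<^sup>2) + \<alpha>m / (\<rho>m * am\<^sup>2) = S / (\<rho>p * \<rho>m)"
    using pos by (simp add: S_def dp_def dm_def field_simps)
  \<comment> \<open>The harmonic form thus equates \<open>1 / (\<rho> * c\<^sup>2)\<close> with
    \<open>1 / (\<rho> * C)\<close>, and taking reciprocals recovers
    \<open>c\<^sup>2 = C\<close>.\<close>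
  also have "\<dots> = 1 / (\<rho> * C)"
    using \<open>\<rho> > 0\<close> by (simp add: C k_def)
  finally have "c\<^sup>2 = C \<longleftrightarrow> 1 / (\<rho> * c\<^sup>2) = \<alpha>p / (\<rho>p * ap\<^sup>2) + \<alpha>m / (\<rho>m * am\<^sup>2)" if "c > 0" for c
    using \<open>\<rho> > 0\<close> by simp
  with uniq \<open>invertible M\<close> \<open>cw > 0\<close> cw2 eig show ?thesis
    unfolding W0_def C[symmetric] C_def by blast
qed

end
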